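(* Let $l\ge1$ be an integer and let $0<p_0<p_1<\cdots<p_l<1$. For each integer $N\ge l$ let $M_i=M_i(N)$, $i=1,\dots,l$, be integers with $1\le M_1<\cdots<M_l\le N$, and suppose that $\frac{M_i}{N}\to r_i$ as $N\to\infty$ for $i=1,\dots,l$. Set $M_0=0$, $M_{l+1}=N+1$, $r_0=0$, $r_{l+1}=1$. Let $P_N$ denote probabilities for the random walk $\{X_n\}_{n=0}^\infty$ excited by its recent history with history window $N$, thresholds $M_1,\dots,M_l$ and probabilities $p_0,\dots,p_l$. Assume that $$ \operatorname{argmax}_{i\in\{0,\dots,l\}:\ r_i<p_i<r_{i+1}}\frac1{p_i^{r_i}(1-p_i)^{1-r_i}}\prod_{k=1}^i\left(\frac{p_{k-1}}{1-p_{k-1}}\right)^{r_k-r_{k-1}}=\{i_0\}. $$ Then, if the deterministic times $\{T_N\}$ converge to infinity sufficiently fast (that is, there exist deterministic times $\tau_N$ such that the following holds for every sequence of deterministic nonnegative integers $T_N\to\infty$ with $T_N\ge\tau_N$ for all $N$), the process $\{X_{N+T_N+n}-X_{N+T_N}\}_{n=1}^\infty$ converges weakly as $N\to\infty$ to the simple random walk with probability $p_{i_0}$ of jumping to the right and $1-p_{i_0}$ of jumping to the left; that is, for all $m\ge1$ and all $(e_1,\dots,e_m)\in\{-1,1\}^m$, $$ \lim_{N\to\infty}P_N\left(X_{N+T_N+1}-X_{N+T_N}=e_1,\dots,X_{N+T_N+m}-X_{N+T_N+m-1}=e_m\right)=p_{i_0}^{|\{i\in[m]:\,e_i=1\}|}(1-p_{i_0})^{|\{i\in[m]:\,e_i=-1\}|}.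 $$
   Context: The process (random walk excited by its recent history, $l$ threshold stages): with $M_0=0$ and $M_{l+1}=N+1$, $\{X_n\}_{n=0}^\infty$ takes values in $\mathbb{Z}$, starts from a fixed integer $X_0$, and at each step jumps by $+1$ (right) or $-1$ (left). Each of the first $N$ jumps is, independently, to the right with probability $p_0$ and to the left with probability $1-p_0$. At every subsequent step, conditionally on the whole past: for $i=0,1,\dots,l$, if the number of jumps to the right among the $N$ most recent jumps is between $M_i$ and $M_{i+1}-1$ (inclusive), then the next jump is to the right with probability $p_i$ and to the left with probability $1-p_i$. A void product $\prod_{k=1}^0$ equals $1$. Notation: $\operatorname{argmax}_{i\in A}f(i)=\{j\in A: f(j)=\max_{i\in A}f(i)\}$ and $[m]=\{1,\dots,m\}$. *)

theory Defs
  imports "HOL-Probability.Probability"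
begin

definition argmax_set :: "'i set \<Rightarrow> ('i \<Rightarrow> real) \<Rightarrow> 'i set" where
  "argmax_set A f = {j \<in> A. f j = Max (f ` A)}"

(* Number of jumps to the right among the N most recent jumps of the path x before time n;
   only used for N \<le> n. *)
definition right_jumps :: "nat \<Rightarrow> (nat \<Rightarrow> int) \<Rightarrow> nat \<Rightarrow> nat" where
  "right_jumps N x n = card {j \<in> {n - N..<n}. x (Suc j) - x j = 1}"

(* Law of the walk with history window N, thresholds M 0, ..., M (l + 1), jump probabilities
   p 0, ..., p l and starting point x0. The conditional law given the whole past is expressed by
   elementary conditional probabilities given each path x 0, ..., x n of positive probability.
   The probabilities of jumping to the left are determined by the jumps being -1 or 1. *)
locale recent_history_walk = prob_space P
  for P :: "'a measure" +
  fixes l N :: nat and M :: "nat \<Rightarrow> nat" and p :: "nat \<Rightarrow> real"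
    and x0 :: int and X :: "nat \<Rightarrow> 'a \<Rightarrow> int"
  assumes X_measurable: "\<And>n. X n \<in> measurable P (count_space UNIV)"
    and start: "AE \<omega> in P. X 0 \<omega> = x0"
    and jumps: "\<And>n. AE \<omega> in P. X (Suc n) \<omega> - X n \<omega> \<in> {-1, 1}"
    and initial_indep:
      "indep_vars (\<lambda>_. count_space UNIV) (\<lambda>n \<omega>. X (Suc n) \<omega> - X n \<omega>) {..<N}"
    and initial_right: "\<And>n. n < N \<Longrightarrow> \<P>(\<omega> in P. X (Suc n) \<omega> - X n \<omega> = 1) = p 0"
    and step_right: "\<And>n i x. N \<le> n \<Longrightarrow> i \<le> l \<Longrightarrow>
      \<P>(\<omega> in P. \<forall>j\<le>n. X j \<omega> = x j) > 0 \<Longrightarrow>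
      M i \<le> right_jumps N x n \<Longrightarrow> right_jumps N x n < M (Suc i) \<Longrightarrow>
      \<P>(\<omega> in P. X (Suc n) \<omega> - X n \<omega> = 1 \<bar> \<forall>j\<le>n. X j \<omega> = x j) = p i"

end

(* The window of the last N jumps is a Markov chain on words of length N. Its stationary weight at a
   word with k ones depends only on k: it is pot k / (1 - q k), where q k is the probability of a
   jump to the right and pot k is the product of the odds q j / (1 - q j) over j < k. Since q is
   increasing, ln pot is convex and piecewise linear, so pot k is the maximum over i of
   A i * p i ^ k * (1 - p i) ^ (N - k), with equality at i on the i-th zone. Summing over words, the
   i-th zone has weight at most of order A i, whereas the total weight is at least every A i.
   Moreover A i ^ (1 / N) converges to the quantity maximised in the statement, and an index i that
   violates r i < p i < r (i + 1) is strictly beaten by one of its neighbours. Hence the stationary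
   law concentrates on the zone of i0, where jumps to the right have probability p i0. *)

theory Submission
  imports Defs
begin

section \<open>Words and the window chain\<close>

definition words :: "nat \<Rightarrow> bool list set" where
  "words n = {s. length s = n}"

abbreviation ones :: "bool list \<Rightarrow> nat" where
  "ones s \<equiv> count_list s True"

lemma length_words: "s \<in> words n \<longleftrightarrow> length s = n"
  by (simp add: words_def)

lemma finite_words [simp]: "finite (words n)"
  using finite_lists_length_eq[of "UNIV :: bool set" n] by (simp add: words_def)

lemma words_0 [simp]: "words 0 = {[]}"
  by (auto simp: words_def)

lemma ones_le_length: "ones s \<le> length s"
  by (rule count_le_length)

lemma sum_words_Cons:
  fixes g :: "bool list \<Rightarrow> 'b::comm_monoid_add"
  shows "(\<Sum>h\<in>words (Suc n). g h) = (\<Sum>h\<in>words n. g (True # h) + g (False # h))"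
proof -
  have "words (Suc n) = Cons True ` words n \<union> Cons False ` words n"
    by (auto simp: words_def length_Suc_conv)
  moreover have "Cons True ` words n \<inter> Cons False ` words n = {}"
    by auto
  ultimately show ?thesis
    by (simp add: sum.union_disjoint sum.reindex sum.distrib inj_on_def)
qed

lemma sum_words_snoc:
  fixes g :: "bool list \<Rightarrow> 'b::comm_monoid_add"
  shows "(\<Sum>h\<in>words (Suc n). g h) = (\<Sum>h\<in>words n. g (h @ [True]) + g (h @ [False]))"
proof -
  have "words (Suc n) = (\<lambda>h. h @ [True]) ` words n \<union> (\<lambda>h. h @ [False]) ` words n"
    by (auto simp: words_def length_Suc_conv_rev image_iff)
  moreover have "(\<lambda>h. h @ [True]) ` words n \<inter> (\<lambda>h. h @ [False]) ` words n = {}"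
    by auto
  ultimately show ?thesis
    by (simp add: sum.union_disjoint sum.reindex sum.distrib inj_on_def)
qed

text \<open>Total mass of \<open>n\<close> independent trials with success probability
  \<open>x\<close>, as the expansion over the first letter shows. Summing over words avoids binomial
  coefficients.\<close>

lemma sum_words_bernoulli:
  fixes x :: real
  shows "(\<Sum>s\<in>words n. x ^ ones s * (1 - x) ^ (n - ones s)) = 1"
proof (induction n)
  case (Suc n)
  have "(\<Sum>s\<in>words (Suc n). x ^ ones s * (1 - x) ^ (Suc n - ones s))
      = (\<Sum>s\<in>words n. x * (x ^ ones s * (1 - x) ^ (n - ones s))
          + (1 - x) * (x ^ ones s * (1 - x) ^ (n - ones s)))"
    unfolding sum_words_Cons
  proof (rule sum.cong[OF refl])
    fix s assume "s \<in> words n"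
    then have "ones s \<le> n"
      using ones_le_length[of s] by (simp add: length_words)
    then show "x ^ ones (True # s) * (1 - x) ^ (Suc n - ones (True # s))
        + x ^ ones (False # s) * (1 - x) ^ (Suc n - ones (False # s))
        = x * (x ^ ones s * (1 - x) ^ (n - ones s))
          + (1 - x) * (x ^ ones s * (1 - x) ^ (n - ones s))"
      by (simp add: Suc_diff_le)
  qed
  also have "\<dots> = (\<Sum>s\<in>words n. x ^ ones s * (1 - x) ^ (n - ones s))"
    by (intro sum.cong) (auto simp: algebra_simps)
  finally show ?case
    using Suc by simp
qed simp

section \<open>The potential and the transition operator of the window chain\<close>

definition pot :: "(nat \<Rightarrow> real) \<Rightarrow> nat \<Rightarrow> real" where
  "pot q k = (\<Prod>j<k. q j / (1 - q j))"

text \<open>Every letter is appended with probability at least \<delta>, whatever the window; this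
  is the source of the contraction.\<close>

locale window_chain =
  fixes N :: nat and q :: "nat \<Rightarrow> real" and \<delta> :: real
  assumes N_pos: "0 < N" and \<delta>_pos: "0 < \<delta>"
    and q_ge: "\<And>k. \<delta> \<le> q k" and q_le: "\<And>k. q k \<le> 1 - \<delta>"
begin

lemma q_pos: "0 < q k" and q_less_1: "q k < 1"
  using \<delta>_pos q_ge[of k] q_le[of k] by auto

lemma \<delta>_less_1: "\<delta> < 1"
  using q_ge[of 0] q_less_1[of 0] by simp

definition jump_prob :: "bool list \<Rightarrow> bool \<Rightarrow> real" where
  "jump_prob s b = (if b then q (ones s) else 1 - q (ones s))"

lemma jump_prob_ge: "\<delta> \<le> jump_prob s b"
  using q_ge q_le[of "ones s"] by (auto simp: jump_prob_def)

lemma jump_prob_Not: "jump_prob s (\<not> b) = 1 - jump_prob s b"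
  by (simp add: jump_prob_def)

lemma jump_prob_nonneg: "0 \<le> jump_prob s b" and jump_prob_le_1: "jump_prob s b \<le> 1"
  using jump_prob_ge[of s b] jump_prob_ge[of s "\<not> b"] \<delta>_pos by (auto simp: jump_prob_Not)

text \<open>The transition operator acting on functions: the expectation of \<open>f\<close> after
  one step from \<open>s\<close>. The oldest letter is the head and is dropped; the newest is
  appended at the end. Laws enter only later, as weights.\<close>

definition step :: "(bool list \<Rightarrow> real) \<Rightarrow> bool list \<Rightarrow> real" where
  "step f s = jump_prob s True * f (tl s @ [True]) + jump_prob s False * f (tl s @ [False])"

lemma step_alt:
  "step f s = jump_prob s b * f (tl s @ [b]) + (1 - jump_prob s b) * f (tl s @ [\<not> b])"
  by (cases b) (auto simp: step_def jump_prob_def)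

lemma shift_words: "s \<in> words N \<Longrightarrow> tl s @ [b] \<in> words N"
  using N_pos by (simp add: length_words)

lemma step_bounds:
  assumes "\<And>s. s \<in> words N \<Longrightarrow> a \<le> f s \<and> f s \<le> b" and s: "s \<in> words N"
  shows "a \<le> step f s \<and> step f s \<le> b"
proof -
  define t where "t = jump_prob s True"
  have t: "0 \<le> t" "t \<le> 1"
    by (auto simp: t_def jump_prob_nonneg jump_prob_le_1)
  define x y where "x = f (tl s @ [True])" and "y = f (tl s @ [False])"
  have xy: "a \<le> x" "x \<le> b" "a \<le> y" "y \<le> b"
    using assms(1)[OF shift_words[OF s]] by (auto simp: x_def y_def)
  have st: "step f s = t * x + (1 - t) * y"
    using step_alt[of f s True] by (simp add: t_def x_def y_def)
  have "0 \<le> t * (x - a) + (1 - t) * (y - a)" "0 \<le> t * (b - x) + (1 - t) * (b - y)"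
    using t xy by auto
  then show ?thesis
    unfolding st by (simp add: algebra_simps)
qed

section \<open>Contraction of the range of a function\<close>

lemma step_iter_bounds:
  assumes "\<And>s. s \<in> words N \<Longrightarrow> a \<le> f s \<and> f s \<le> b" and "s \<in> words N"
  shows "a \<le> (step ^^ n) f s \<and> (step ^^ n) f s \<le> b"
  using assms(2)
proof (induction n arbitrary: s)
  case (Suc n)
  then show ?case
    using step_bounds[of a "(step ^^ n) f" b] by simp
qed (use assms(1) in simp)

lemma step_iter_minus: "(step ^^ n) (\<lambda>s. - f s) = (\<lambda>s. - (step ^^ n) f s)"
  by (induction n) (auto simp: step_def)

text \<open>The next \<open>n\<close> letters are exactly \<open>e\<close> with probability at least
  \<delta> to the power \<open>n\<close>, and all other continuations contribute at least
  \<open>a\<close>. For \<open>n = N\<close> the word \<open>e\<close> replaces the whole window, so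
  the bound no longer depends on \<open>s\<close>.\<close>

lemma step_iter_ge:
  assumes ge: "\<And>s. s \<in> words N \<Longrightarrow> a \<le> f s"
    and "length e = n" "n \<le> N" "s \<in> words N"
  shows "a + \<delta> ^ n * (f (drop n s @ e) - a) \<le> (step ^^ n) f s"
  using assms(2-)
proof (induction n arbitrary: s e)
  case (Suc n)
  then obtain b e' where e: "e = b # e'" "length e' = n"
    by (auto simp: length_Suc_conv)
  have s: "length s = N"
    using Suc.prems by (simp add: length_words)
  define g where "g = (step ^^ n) f"
  \<comment> \<open>\<open>step_iter_bounds\<close> also asks for an upper bound; the maximum over
    the finite set of words serves.\<close>
  have "a \<le> (step ^^ n) f t" if "t \<in> words N" for t
    using step_iter_bounds[of a f "Max (f ` words N)" t n] ge that by auto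
  then have g_ge: "a \<le> g (tl s @ [c])" for c
    using shift_words[of s c] Suc.prems by (simp add: g_def)
  have "drop n (tl s @ [b]) @ e' = drop (Suc n) s @ e"
    using Suc.prems s by (simp add: e drop_Suc)
  then have ind: "a + \<delta> ^ n * (f (drop (Suc n) s @ e) - a) \<le> g (tl s @ [b])"
    using Suc.IH[OF e(2) _ shift_words[of s b]] Suc.prems by (simp add: g_def)
  define t where "t = jump_prob s b"
  have t: "\<delta> \<le> t" "t \<le> 1"
    by (auto simp: t_def jump_prob_ge jump_prob_le_1)
  have "\<delta> ^ Suc n * (f (drop (Suc n) s @ e) - a) \<le> \<delta> * (g (tl s @ [b]) - a)"
    using ind \<delta>_pos by (simp add: mult.assoc)
  also have "\<dots> \<le> t * (g (tl s @ [b]) - a)"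
    using t g_ge by (intro mult_right_mono) auto
  also have "\<dots> \<le> t * (g (tl s @ [b]) - a) + (1 - t) * (g (tl s @ [\<not> b]) - a)"
    using t g_ge by simp
  also have "\<dots> = step g s - a"
    by (subst step_alt[of g s b]) (simp add: t_def algebra_simps)
  finally show ?case
    by (simp add: g_def)
qed simp

text \<open>Doeblin's argument: all starting windows share the target \<open>e\<close> with mass at
  least \<delta> to the power \<open>N\<close>, so both ends of the range move towards
  \<open>f e\<close> by that proportion.\<close>

lemma step_N_contraction:
  assumes f: "\<And>s. s \<in> words N \<Longrightarrow> a \<le> f s \<and> f s \<le> b"
  shows "\<exists>a' b'. b' - a' = (1 - \<delta> ^ N) * (b - a) \<and>
    (\<forall>s\<in>words N. a' \<le> (step ^^ N) f s \<and> (step ^^ N) f s \<le> b')"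
proof -
  \<comment> \<open>Any fixed word of length \<open>N\<close> would serve as the common
    target.\<close>
  define e where "e = replicate N True"
  have e: "length e = N"
    by (simp add: e_def)
  show ?thesis
  proof (intro exI conjI ballI)
    show "(b - \<delta> ^ N * (b - f e)) - (a + \<delta> ^ N * (f e - a)) = (1 - \<delta> ^ N) * (b - a)"
      by (simp add: algebra_simps)
    fix s assume s: "s \<in> words N"
    have d: "drop N s @ e = e"
      using s by (simp add: length_words)
    \<comment> \<open>The upper bound is the lower bound for \<open>- f\<close>.\<close>
    show "a + \<delta> ^ N * (f e - a) \<le> (step ^^ N) f s" "(step ^^ N) f s \<le> b - \<delta> ^ N * (b - f e)"
      using step_iter_ge[of a f e N s] step_iter_ge[of "- b" "\<lambda>s. - f s" e N s] f s e d
      by (auto simp: step_iter_minus algebra_simps)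
  qed
qed

lemma step_iter_contraction:
  assumes "\<And>s. s \<in> words N \<Longrightarrow> a \<le> f s \<and> f s \<le> b"
  shows "\<exists>a' b'. b' - a' = (1 - \<delta> ^ N) ^ j * (b - a) \<and>
    (\<forall>s\<in>words N. a' \<le> (step ^^ (j * N)) f s \<and> (step ^^ (j * N)) f s \<le> b')"
  using assms
proof (induction j arbitrary: f a b)
  case (Suc j)
  obtain a1 b1 where 1: "b1 - a1 = (1 - \<delta> ^ N) * (b - a)"
    "\<And>s. s \<in> words N \<Longrightarrow> a1 \<le> (step ^^ N) f s \<and> (step ^^ N) f s \<le> b1"
    using step_N_contraction[of a f b] Suc.prems by blast
  obtain a' b' where 2: "b' - a' = (1 - \<delta> ^ N) ^ j * (b1 - a1)"
    "\<And>s. s \<in> words N \<Longrightarrow> a' \<le> (step ^^ (j * N)) ((step ^^ N) f) s \<and>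
      (step ^^ (j * N)) ((step ^^ N) f) s \<le> b'"
    using Suc.IH[where f = "(step ^^ N) f", OF 1(2)] by blast
  have "Suc j * N = j * N + N"
    by simp
  then have "(step ^^ (Suc j * N)) f = (step ^^ (j * N)) ((step ^^ N) f)"
    by (simp only: funpow_add comp_apply)
  moreover have "b' - a' = (1 - \<delta> ^ N) ^ Suc j * (b - a)"
    unfolding 1(1) 2(1) by (simp only: power_Suc mult.assoc mult.left_commute)
  ultimately show ?case
    using 2(2) by metis
qed auto

section \<open>Stationary weights and uniform ergodicity\<close>

definition stat :: "bool list \<Rightarrow> real" where
  "stat s = pot q (ones s) / (1 - q (ones s))"

lemma pot_pos: "0 < pot q k"
  unfolding pot_def using q_pos q_less_1 by (intro prod_pos) auto

lemma stat_pos: "0 < stat s"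
  using pot_pos q_less_1 by (simp add: stat_def)

lemma stat_step:
  "(\<Sum>s\<in>words N. stat s * step f s) = (\<Sum>s\<in>words N. stat s * f s)"
proof -
  obtain n where n: "N = Suc n"
    using N_pos gr0_conv_Suc by auto
  \<comment> \<open>Only \<open>True # u\<close> and \<open>False # u\<close> can move to a window
    \<open>u @ [c]\<close>. Both identities follow from the recursion of \<open>pot\<close>: its
    value at \<open>Suc k\<close> is its value at \<open>k\<close> times the odds of
    \<open>q k\<close>.\<close>
  have balance: "stat (True # u) * q (ones (True # u)) + stat (False # u) * q (ones (False # u))
        = stat (u @ [True])"
      "stat (True # u) * (1 - q (ones (True # u))) + stat (False # u) * (1 - q (ones (False # u)))
        = stat (u @ [False])" for u
    using q_less_1[of "ones u"] q_less_1[of "Suc (ones u)"]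
    by (simp_all add: stat_def pot_def divide_simps) (simp_all add: algebra_simps)
  show ?thesis
    \<comment> \<open>One side is split by its oldest letter and the other by its newest, which
      leaves the same sum over the \<open>n\<close> shared letters \<open>u\<close>.\<close>
    unfolding n sum_words_Cons[of "\<lambda>s. stat s * step f s"] sum_words_snoc[of "\<lambda>s. stat s * f s"]
  proof (rule sum.cong[OF refl])
    fix u
    have "stat (True # u) * step f (True # u) + stat (False # u) * step f (False # u)
      = (stat (True # u) * q (ones (True # u)) + stat (False # u) * q (ones (False # u))) * f (u @ [True])
      + (stat (True # u) * (1 - q (ones (True # u))) + stat (False # u) * (1 - q (ones (False # u)))) * f (u @ [False])"
      by (simp add: step_def jump_prob_def algebra_simps)
    then show "stat (True # u) * step f (True # u) + stat (False # u) * step f (False # u)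
      = stat (u @ [True]) * f (u @ [True]) + stat (u @ [False]) * f (u @ [False])"
      unfolding balance .
  qed
qed

lemma stat_step_iter:
  "(\<Sum>s\<in>words N. stat s * (step ^^ n) f s) = (\<Sum>s\<in>words N. stat s * f s)"
  by (induction n) (auto simp: stat_step)

lemma weighted_average_bounds:
  fixes w g :: "bool list \<Rightarrow> real"
  assumes "\<And>s. s \<in> words N \<Longrightarrow> 0 \<le> w s" and "\<And>s. s \<in> words N \<Longrightarrow> a \<le> g s \<and> g s \<le> b"
  shows "a * (\<Sum>s\<in>words N. w s) \<le> (\<Sum>s\<in>words N. w s * g s)"
    and "(\<Sum>s\<in>words N. w s * g s) \<le> b * (\<Sum>s\<in>words N. w s)"
  unfolding sum_distrib_left using assms
  by (auto intro!: sum_mono simp: mult.commute[of _ "w _"] mult_left_mono)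

text \<open>The average under the evolved law and the stationary average are both weighted means of
  the values of \<open>(step ^^ n) f\<close>, by invariance of \<open>stat\<close>. Those values lie
  in an interval of length at most \<epsilon>, and the time needed depends neither on
  \<open>f\<close> nor on the initial law \<open>a\<close>.\<close>

lemma uniform_ergodicity:
  assumes "0 < \<epsilon>"
  shows "\<exists>\<tau>. \<forall>n\<ge>\<tau>. \<forall>f a. (\<forall>s\<in>words N. 0 \<le> f s \<and> f s \<le> 1) \<longrightarrow>
    (\<forall>s\<in>words N. 0 \<le> a s) \<longrightarrow> (\<Sum>s\<in>words N. a s) = 1 \<longrightarrow>
    \<bar>(\<Sum>s\<in>words N. a s * (step ^^ n) f s) -
      (\<Sum>s\<in>words N. stat s * f s) / (\<Sum>s\<in>words N. stat s)\<bar> \<le> \<epsilon>"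
proof -
  have "0 < \<delta> ^ N" "\<delta> ^ N < 1"
    using \<delta>_pos \<delta>_less_1 N_pos by (auto simp: power_less_one_iff)
  then obtain j where j: "(1 - \<delta> ^ N) ^ j < \<epsilon>"
    using real_arch_pow_inv[OF assms, of "1 - \<delta> ^ N"] by auto
  show ?thesis
  proof (intro exI[of _ "j * N"] allI impI)
    fix n and f a :: "bool list \<Rightarrow> real"
    assume n: "j * N \<le> n" and f: "\<forall>s\<in>words N. 0 \<le> f s \<and> f s \<le> 1"
      and a: "\<forall>s\<in>words N. 0 \<le> a s" and a1: "(\<Sum>s\<in>words N. a s) = 1"
    obtain a' b' where ab: "b' - a' = (1 - \<delta> ^ N) ^ j"
      and jN: "\<And>s. s \<in> words N \<Longrightarrow> a' \<le> (step ^^ (j * N)) f s \<and> (step ^^ (j * N)) f s \<le> b'"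
      using step_iter_contraction[of 0 f 1 j] f by auto
    have "(step ^^ n) f = (step ^^ (n - j * N)) ((step ^^ (j * N)) f)"
      using n by (metis comp_apply funpow_add le_add_diff_inverse2)
    then have g: "a' \<le> (step ^^ n) f s \<and> (step ^^ n) f s \<le> b'" if "s \<in> words N" for s
      using step_iter_bounds[OF jN that] by simp
    define Z where "Z = (\<Sum>s\<in>words N. stat s)"
    have "words N \<noteq> {}"
      using Ex_list_of_length[of N] by (auto simp: words_def)
    then have Z: "0 < Z"
      unfolding Z_def using stat_pos by (intro sum_pos) auto
    have "a' * Z \<le> (\<Sum>s\<in>words N. stat s * f s)" "(\<Sum>s\<in>words N. stat s * f s) \<le> b' * Z"
      using weighted_average_bounds[of stat a' "(step ^^ n) f" b'] g stat_pos
      by (auto simp: stat_step_iter Z_def less_imp_le)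
    then have "a' \<le> (\<Sum>s\<in>words N. stat s * f s) / Z" "(\<Sum>s\<in>words N. stat s * f s) / Z \<le> b'"
      using Z by (auto simp: field_simps)
    moreover have "a' \<le> (\<Sum>s\<in>words N. a s * (step ^^ n) f s)"
      "(\<Sum>s\<in>words N. a s * (step ^^ n) f s) \<le> b'"
      using weighted_average_bounds[of a a' "(step ^^ n) f" b'] g a a1 by auto
    ultimately show "\<bar>(\<Sum>s\<in>words N. a s * (step ^^ n) f s) -
      (\<Sum>s\<in>words N. stat s * f s) / (\<Sum>s\<in>words N. stat s)\<bar> \<le> \<epsilon>"
      using ab j unfolding Z_def by linarith
  qed
qed

end


section \<open>Thresholds and the concentration of the stationary law\<close>

text \<open>Counting the thresholds passed gives an index that is defined for every
  \<open>k\<close>, monotone in \<open>k\<close> and never above \<open>l\<close>.\<close>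

definition zone :: "(nat \<Rightarrow> nat) \<Rightarrow> nat \<Rightarrow> nat \<Rightarrow> nat" where
  "zone M l k = card {i \<in> {1..l}. M i \<le> k}"

definition odds :: "real \<Rightarrow> real" where
  "odds x = x / (1 - x)"

(* The normalisation makes k \<mapsto> peak * p i ^ k * (1 - p i) ^ (N - k) agree with the potential on the
   i-th zone; summed against binomial coefficients over all k this gives exactly peak. *)
definition peak :: "(nat \<Rightarrow> nat) \<Rightarrow> (nat \<Rightarrow> real) \<Rightarrow> nat \<Rightarrow> nat \<Rightarrow> real" where
  "peak M p N i = (\<Prod>k<i. odds (p k) ^ (M (Suc k) - M k)) / (p i ^ M i * (1 - p i) ^ (N - M i))"

section \<open>Thresholds and the zones between them\<close>

locale thresholds =
  fixes l N :: nat and M :: "nat \<Rightarrow> nat" and p :: "nat \<Rightarrow> real"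
  assumes window_pos: "0 < N"
    and p_0_pos: "0 < p 0" and p_Suc: "\<And>i. i < l \<Longrightarrow> p i < p (Suc i)" and p_l_less: "p l < 1"
    and M_0: "M 0 = 0" and M_top: "M (Suc l) = N + 1"
    and M_Suc: "\<And>i. i \<le> l \<Longrightarrow> M i < M (Suc i)"
begin

lemma p_mono: "i \<le> j \<Longrightarrow> j \<le> l \<Longrightarrow> p i \<le> p j"
proof (induction j rule: dec_induct)
  case (step n)
  then show ?case
    using p_Suc[of n] by simp
qed simp

lemma M_mono: "i \<le> j \<Longrightarrow> j \<le> Suc l \<Longrightarrow> M i \<le> M j"
proof (induction j rule: dec_induct)
  case (step n)
  then show ?case
    using M_Suc[of n] by simp
qed simp

lemma p_pos: "i \<le> l \<Longrightarrow> 0 < p i" and p_less_1: "i \<le> l \<Longrightarrow> p i < 1"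
  using p_mono[of 0 i] p_mono[of i l] p_0_pos p_l_less by auto

lemma M_le_N: "i \<le> l \<Longrightarrow> M i \<le> N"
  using M_mono[of "Suc i" "Suc l"] M_Suc[of i] M_top by simp

lemma zone_le: "zone M l k \<le> l"
proof -
  have "card {i \<in> {1..l}. M i \<le> k} \<le> card {1..l}"
    by (intro card_mono) auto
  then show ?thesis
    by (simp add: zone_def)
qed

lemma zone_mono: "k \<le> k' \<Longrightarrow> zone M l k \<le> zone M l k'"
  unfolding zone_def by (intro card_mono) auto

lemma zone_eq:
  assumes "i \<le> l" "M i \<le> k" "k < M (Suc i)"
  shows "zone M l k = i"
proof -
  have "{j \<in> {1..l}. M j \<le> k} = {1..i}"
  proof (intro equalityI subsetI)
    fix j assume j: "j \<in> {j \<in> {1..l}. M j \<le> k}"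
    then have "\<not> Suc i \<le> j"
      using M_mono[of "Suc i" j] assms by auto
    then show "j \<in> {1..i}"
      using j by auto
  qed (use assms M_mono[of _ i] in force)
  then show ?thesis
    by (simp add: zone_def)
qed

lemma zone_bounds:
  assumes "k \<le> N"
  shows "M (zone M l k) \<le> k" "k < M (Suc (zone M l k))"
proof -
  \<comment> \<open>The first threshold above \<open>k\<close> is \<open>M (Suc i)\<close>; it
    exists with \<open>i \<le> l\<close> because \<open>M 0 = 0\<close> is not above
    \<open>k\<close> and \<open>M (Suc l) = N + 1\<close> is.\<close>
  obtain i where "i < Suc l" "\<not> k < M i" "k < M (Suc i)"
    using ex_least_nat_less[of "\<lambda>i. k < M i" "Suc l"] assms M_0 M_top by auto
  moreover from this have "zone M l k = i"
    by (intro zone_eq) auto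
  ultimately show "M (zone M l k) \<le> k" "k < M (Suc (zone M l k))"
    by auto
qed

lemma zone_M: "i \<le> l \<Longrightarrow> zone M l (M i) = i"
  by (intro zone_eq) (auto simp: M_Suc)

abbreviation rate :: "nat \<Rightarrow> real" where
  "rate k \<equiv> p (zone M l k)"

text \<open>Since \<open>p\<close> is increasing, \<open>p 0\<close> bounds the chance of a right
  jump from below and \<open>1 - p l\<close> that of a left jump.\<close>

sublocale window_chain N rate "min (p 0) (1 - p l)"
proof
  fix k
  show "min (p 0) (1 - p l) \<le> rate k" "rate k \<le> 1 - min (p 0) (1 - p l)"
    using p_mono[of 0 "zone M l k"] p_mono[of "zone M l k" l] zone_le[of k] by auto
qed (use window_pos p_0_pos p_l_less in auto)

lemma odds_pos: "i \<le> l \<Longrightarrow> 0 < odds (p i)"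
  using p_pos p_less_1 by (simp add: odds_def)

lemma odds_mono: "i \<le> j \<Longrightarrow> j \<le> l \<Longrightarrow> odds (p i) \<le> odds (p j)"
  unfolding odds_def using p_mono[of i j] p_pos[of i] p_less_1[of j] by (intro frac_le) auto

section \<open>Convexity of the logarithm of the potential\<close>

lemma pot_Suc: "pot rate (Suc k) = pot rate k * odds (rate k)"
  by (simp add: pot_def odds_def)

text \<open>The right end \<open>M (Suc i)\<close> is included, as the potential at \<open>k\<close>
  involves only the rates strictly below \<open>k\<close>. This lets consecutive zones be chained in
  \<open>pot_M\<close>.\<close>

lemma pot_add:
  assumes "i \<le> l" "M i + d \<le> M (Suc i)"
  shows "pot rate (M i + d) = pot rate (M i) * odds (p i) ^ d"
  using assms(2)
proof (induction d)
  case (Suc d)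
  then have "zone M l (M i + d) = i"
    using assms(1) by (intro zone_eq) auto
  then show ?case
    using Suc by (simp add: pot_Suc)
qed simp

text \<open>From \<open>M i\<close> upwards no factor of the potential is smaller than
  \<open>odds (p i)\<close>: the right half of convexity.\<close>

lemma pot_add_ge:
  assumes "i \<le> l"
  shows "pot rate (M i) * odds (p i) ^ d \<le> pot rate (M i + d)"
proof (induction d)
  case (Suc d)
  have "odds (p i) \<le> odds (rate (M i + d))"
    using zone_mono[of "M i" "M i + d"] zone_M[OF assms] zone_le by (intro odds_mono) auto
  then have "pot rate (M i) * odds (p i) ^ d * odds (p i) \<le> pot rate (M i + d) * odds (rate (M i + d))"
    using Suc odds_pos[OF assms] pot_pos[of "M i + d"] by (intro mult_mono) auto
  then show ?case
    by (simp add: pot_Suc mult.assoc mult.commute[of "odds (p i)"])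
qed simp

text \<open>The left half of convexity: below \<open>M i\<close> every factor is at most
  \<open>odds (p i)\<close>.\<close>

lemma pot_diff_ge:
  assumes "i \<le> l" "d \<le> M i"
  shows "pot rate (M i) \<le> pot rate (M i - d) * odds (p i) ^ d"
  using assms(2)
proof (induction d)
  case (Suc d)
  have "odds (rate (M i - Suc d)) \<le> odds (p i)"
    using zone_mono[of "M i - Suc d" "M i"] zone_M[OF assms(1)] assms(1) by (intro odds_mono) auto
  then have "pot rate (M i - d) \<le> pot rate (M i - Suc d) * odds (p i)"
    using pot_Suc[of "M i - Suc d"] Suc.prems pot_pos[of "M i - Suc d"]
    by (simp add: Suc_diff_Suc mult_left_mono)
  then have "pot rate (M i - d) * odds (p i) ^ d \<le> pot rate (M i - Suc d) * odds (p i) * odds (p i) ^ d"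
    using odds_pos[OF assms(1)] by (intro mult_right_mono) auto
  then show ?case
    using Suc by (simp add: mult.assoc)
qed simp

lemma pot_M: "i \<le> l \<Longrightarrow> pot rate (M i) = (\<Prod>k<i. odds (p k) ^ (M (Suc k) - M k))"
proof (induction i)
  case (Suc i)
  then show ?case
    using pot_add[of i "M (Suc i) - M i"] M_Suc[of i] by simp
qed (simp add: M_0 pot_def)

lemma peak_pos: "i \<le> l \<Longrightarrow> 0 < peak M p N i"
  unfolding peak_def using p_pos p_less_1 odds_pos by (intro divide_pos_pos prod_pos) auto

text \<open>At \<open>d = 0\<close> this is the normalisation chosen in \<open>peak\<close>; each
  further unit of \<open>d\<close> trades a factor \<open>1 - p i\<close> for \<open>p i\<close>,
  that is, multiplies by \<open>odds (p i)\<close>.\<close>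

lemma peak_add:
  assumes "i \<le> l" "M i + d \<le> N"
  shows "peak M p N i * (p i ^ (M i + d) * (1 - p i) ^ (N - (M i + d)))
    = pot rate (M i) * odds (p i) ^ d"
proof -
  have "N - M i = N - (M i + d) + d"
    using assms by simp
  then have "(1 - p i) ^ (N - M i) = (1 - p i) ^ (N - (M i + d)) * (1 - p i) ^ d"
    by (metis power_add)
  then show ?thesis
    using p_pos[OF assms(1)] p_less_1[OF assms(1)]
    by (simp add: peak_def pot_M[OF assms(1)] odds_def power_add power_divide field_simps)
qed

lemma peak_diff:
  assumes "i \<le> l" "d \<le> M i"
  shows "peak M p N i * (p i ^ (M i - d) * (1 - p i) ^ (N - (M i - d))) * odds (p i) ^ d = pot rate (M i)"
proof -
  have "N - (M i - d) = N - M i + d" "M i = M i - d + d"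
    using assms M_le_N[of i] by simp_all
  then have "(1 - p i) ^ (N - (M i - d)) = (1 - p i) ^ (N - M i) * (1 - p i) ^ d"
    "p i ^ M i = p i ^ (M i - d) * p i ^ d"
    by (metis power_add)+
  then show ?thesis
    using p_pos[OF assms(1)] p_less_1[OF assms(1)]
    by (simp add: peak_def pot_M[OF assms(1)] odds_def power_divide field_simps)
qed

lemma pot_zone:
  assumes "k \<le> N" "zone M l k = i"
  shows "pot rate k = peak M p N i * (p i ^ k * (1 - p i) ^ (N - k))"
proof -
  have "i \<le> l" "M i \<le> k" "k < M (Suc i)"
    using assms zone_le zone_bounds by auto
  then show ?thesis
    using pot_add[of i "k - M i"] peak_add[of i "k - M i"] assms by simp
qed

(* The logarithm of the potential is convex and piecewise linear, so each of its linear pieces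
   stays below it when extended. *)
lemma pot_ge_peak:
  assumes "i \<le> l" "k \<le> N"
  shows "peak M p N i * (p i ^ k * (1 - p i) ^ (N - k)) \<le> pot rate k"
proof (cases "M i \<le> k")
  case True
  then show ?thesis
    using pot_add_ge[of i "k - M i"] peak_add[of i "k - M i"] assms by simp
next
  case False
  then have "peak M p N i * (p i ^ k * (1 - p i) ^ (N - k)) * odds (p i) ^ (M i - k)
      \<le> pot rate k * odds (p i) ^ (M i - k)"
    using pot_diff_ge[of i "M i - k"] peak_diff[of i "M i - k"] assms by simp
  then show ?thesis
    using odds_pos[OF assms(1)] by simp
qed

section \<open>Stationary weight of the zones\<close>

lemma stat_total_ge:
  assumes "i \<le> l"
  shows "peak M p N i \<le> (\<Sum>s\<in>words N. stat s)"
proof -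
  have "peak M p N i = (\<Sum>s\<in>words N. peak M p N i * (p i ^ ones s * (1 - p i) ^ (N - ones s)))"
    by (simp add: sum_words_bernoulli flip: sum_distrib_left)
  also have "\<dots> \<le> (\<Sum>s\<in>words N. stat s)"
  proof (rule sum_mono)
    fix s assume "s \<in> words N"
    \<comment> \<open>The \<open>i\<close>-th exponential piece is extended below the potential to
      all words, so that its sum is a full Bernoulli mass; the factor \<open>1 / (1 - q)\<close> in
      \<open>stat\<close> is at least 1 and is dropped.\<close>
    then have "peak M p N i * (p i ^ ones s * (1 - p i) ^ (N - ones s)) \<le> pot rate (ones s)"
      using ones_le_length[of s] by (intro pot_ge_peak assms) (simp add: length_words)
    also have "\<dots> \<le> stat s"
      using q_pos[of "ones s"] q_less_1[of "ones s"] pot_pos[of "ones s"]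
      by (simp add: stat_def field_simps)
    finally show "peak M p N i * (p i ^ ones s * (1 - p i) ^ (N - ones s)) \<le> stat s" .
  qed
  finally show ?thesis .
qed

text \<open>On its own zone \<open>stat\<close> is the exponential piece of that zone up to a factor
  of at most \<open>1 / (1 - p l)\<close>. Summing each piece over all words rather than over its
  zone gives exactly \<open>peak\<close>.\<close>

lemma stat_outside_le:
  "(\<Sum>s\<in>words N. stat s * of_bool (zone M l (ones s) \<noteq> j)) \<le> (\<Sum>i\<in>{..l} - {j}. peak M p N i) / (1 - p l)"
proof -
  define f where "f i s = peak M p N i * (p i ^ ones s * (1 - p i) ^ (N - ones s))" for i s
  have f_nonneg: "0 \<le> f i s" if "i \<le> l" for i s
    using peak_pos[OF that] p_pos[OF that] p_less_1[OF that] by (simp add: f_def)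
  have "stat s * of_bool (zone M l (ones s) \<noteq> j) \<le> (\<Sum>i\<in>{..l} - {j}. f i s) / (1 - p l)"
    if "s \<in> words N" for s
  proof (cases "zone M l (ones s) = j")
    case True
    then show ?thesis
      using f_nonneg p_l_less by (auto intro!: divide_nonneg_pos sum_nonneg)
  next
    case False
    define i where "i = zone M l (ones s)"
    have i: "i \<in> {..l} - {j}"
      using False zone_le by (auto simp: i_def)
    have "stat s = f i s / (1 - p i)"
      using pot_zone[of "ones s" i] ones_le_length[of s] that
      by (simp add: stat_def f_def i_def length_words)
    also have "\<dots> \<le> f i s / (1 - p l)"
      using i f_nonneg[of i s] p_l_less p_mono[of i l] by (intro divide_left_mono) auto
    \<comment> \<open>Adding the pieces of the other zones makes the bound independent of the zone
      of \<open>s\<close>, so the two sums can be exchanged.\<close>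
    also have "\<dots> \<le> (\<Sum>i\<in>{..l} - {j}. f i s) / (1 - p l)"
      using i p_l_less f_nonneg by (intro divide_right_mono member_le_sum) auto
    finally show ?thesis
      using False by simp
  qed
  then have "(\<Sum>s\<in>words N. stat s * of_bool (zone M l (ones s) \<noteq> j))
      \<le> (\<Sum>s\<in>words N. (\<Sum>i\<in>{..l} - {j}. f i s) / (1 - p l))"
    by (rule sum_mono)
  also have "\<dots> = (\<Sum>i\<in>{..l} - {j}. \<Sum>s\<in>words N. f i s) / (1 - p l)"
    by (subst sum.swap) (simp add: sum_divide_distrib)
  also have "(\<Sum>i\<in>{..l} - {j}. \<Sum>s\<in>words N. f i s) = (\<Sum>i\<in>{..l} - {j}. peak M p N i)"
    by (simp add: f_def sum_words_bernoulli flip: sum_distrib_left)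
  finally show ?thesis .
qed

lemma stat_ratio_outside_le:
  assumes "j \<le> l"
  shows "(\<Sum>s\<in>words N. stat s * of_bool (zone M l (ones s) \<noteq> j)) / (\<Sum>s\<in>words N. stat s)
    \<le> (\<Sum>i\<in>{..l} - {j}. peak M p N i / peak M p N j) / (1 - p l)"
proof -
  have "(\<Sum>s\<in>words N. stat s * of_bool (zone M l (ones s) \<noteq> j)) / (\<Sum>s\<in>words N. stat s)
      \<le> ((\<Sum>i\<in>{..l} - {j}. peak M p N i) / (1 - p l)) / peak M p N j"
    using stat_outside_le stat_total_ge[OF assms] peak_pos p_l_less
    by (intro frac_le) (auto intro!: divide_nonneg_pos sum_nonneg simp: less_imp_le assms)
  then show ?thesis
    by (simp add: sum_divide_distrib mult.commute)
qed

text \<open>The exponents are real differences here, so dividing by \<open>N\<close> leaves a linear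
  expression in the ratios \<open>M i / N\<close>, whose limit is immediate.\<close>

lemma ln_peak:
  assumes "i \<le> l"
  shows "ln (peak M p N i) = (\<Sum>k<i. (real (M (Suc k)) - real (M k)) * ln (odds (p k)))
    - real (M i) * ln (p i) - (real N - real (M i)) * ln (1 - p i)"
proof -
  define Q where "Q = (\<Prod>k<i. odds (p k) ^ (M (Suc k) - M k))"
  have "ln Q = (\<Sum>k<i. ln (odds (p k) ^ (M (Suc k) - M k)))"
    using assms odds_pos[THEN dual_order.strict_implies_not_eq] unfolding Q_def by (intro ln_prod) auto
  also have "\<dots> = (\<Sum>k<i. (real (M (Suc k)) - real (M k)) * ln (odds (p k)))"
  proof (rule sum.cong[OF refl])
    fix k assume "k \<in> {..<i}"
    then have "k \<le> l"
      using assms by simp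
    then show "ln (odds (p k) ^ (M (Suc k) - M k)) = (real (M (Suc k)) - real (M k)) * ln (odds (p k))"
      using odds_pos[of k] M_Suc[of k] by (simp add: ln_realpow of_nat_diff)
  qed
  finally have 1: "ln Q = \<dots>" .
  have "0 < Q"
    unfolding Q_def
    using assms odds_pos by (intro prod_pos) auto
  then show ?thesis
    using p_pos[OF assms] p_less_1[OF assms] M_le_N[OF assms] 1
    by (simp add: peak_def Q_def [symmetric] ln_div ln_mult ln_realpow of_nat_diff)
qed

end

section \<open>Exponential rates and the maximising index\<close>

lemma mixed_ln_less:
  fixes x a b :: real
  assumes "0 < a" "a < 1" "0 < b" "b < 1" "a \<noteq> b" "0 \<le> x" "x \<le> 1" "(a - b) * (x - b) \<le> 0"
  shows "x * ln a + (1 - x) * ln (1 - a) < x * ln b + (1 - x) * ln (1 - b)"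
proof -
  have strict: "ln u < u - 1" if "0 < u" "u \<noteq> 1" for u :: real
    using ln_le_minus_one[OF that(1)] ln_eq_minus_one[OF that(1)] that(2) by fastforce
  have a: "ln a - ln b < a / b - 1"
    using strict[of "a / b"] assms by (simp add: ln_div)
  have b: "ln (1 - a) - ln (1 - b) < (1 - a) / (1 - b) - 1"
    using strict[of "(1 - a) / (1 - b)"] assms by (simp add: ln_div)
  \<comment> \<open>Both logarithmic differences are replaced by their tangent bounds. What results
    has the sign of \<open>(a - b) * (x - b)\<close>, which is not positive because \<open>b\<close>
    separates \<open>a\<close> from \<open>x\<close>.\<close>
  have "x * (ln a - ln b) + (1 - x) * (ln (1 - a) - ln (1 - b))
      < x * (a / b - 1) + (1 - x) * ((1 - a) / (1 - b) - 1)"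
  \<comment> \<open>Strictness comes from the first term when \<open>x\<close> is positive, and from
    the second when \<open>x = 0\<close>.\<close>
  proof (cases "x = 0")
    case False
    then show ?thesis
      using a b assms by (intro add_less_le_mono mult_strict_left_mono mult_left_mono) auto
  qed (use b in simp)
  also have "\<dots> = (a - b) * (x - b) / (b * (1 - b))"
    using assms by (simp add: field_simps)
  also have "\<dots> \<le> 0"
    using assms by (intro divide_nonpos_pos) auto
  finally show ?thesis
    by (simp add: algebra_simps)
qed

text \<open>The logarithm of the quantity maximised in the theorem, and at the same time the limit
  of \<open>ln (peak M p N i) / N\<close>.\<close>

definition log_rate :: "(nat \<Rightarrow> real) \<Rightarrow> (nat \<Rightarrow> real) \<Rightarrow> nat \<Rightarrow> real" where
  "log_rate p r i = (\<Sum>k<i. (r (Suc k) - r k) * ln (odds (p k))) - r i * ln (p i) - (1 - r i) * ln (1 - p i)"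

lemma exp_log_rate:
  assumes "\<And>k. k \<le> i \<Longrightarrow> 0 < p k \<and> p k < 1"
  shows "1 / (p i powr r i * (1 - p i) powr (1 - r i)) *
      (\<Prod>k=1..i. (p (k - 1) / (1 - p (k - 1))) powr (r k - r (k - 1))) = exp (log_rate p r i)"
proof -
  have "(\<Prod>k=1..i. (p (k - 1) / (1 - p (k - 1))) powr (r k - r (k - 1)))
      = (\<Prod>k<i. odds (p k) powr (r (Suc k) - r k))"
    unfolding odds_def by (rule prod.reindex_bij_witness[of _ Suc "\<lambda>k. k - 1"]) auto
  also have "\<dots> = (\<Prod>k<i. exp ((r (Suc k) - r k) * ln (odds (p k))))"
  proof (rule prod.cong[OF refl])
    fix k assume "k \<in> {..<i}"
    then have "odds (p k) \<noteq> 0"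
      using assms[of k] by (simp add: odds_def)
    then show "odds (p k) powr (r (Suc k) - r k) = exp ((r (Suc k) - r k) * ln (odds (p k)))"
      by (simp add: powr_def)
  qed
  also have "\<dots> = exp (\<Sum>k<i. (r (Suc k) - r k) * ln (odds (p k)))"
    by (simp add: exp_sum)
  finally have 1: "(\<Prod>k=1..i. (p (k - 1) / (1 - p (k - 1))) powr (r k - r (k - 1))) = \<dots>" .
  have "p i \<noteq> 0" "1 - p i \<noteq> 0"
    using assms[of i] by auto
  then show ?thesis
    unfolding 1 by (simp add: log_rate_def powr_def exp_diff)
qed

text \<open>Neighbouring rates differ by two mixed logarithms with the same weight
  \<open>r (Suc i)\<close>, exactly the form that \<open>mixed_ln_less\<close> compares.\<close>

lemma log_rate_Suc:
  assumes "0 < p i" "p i < 1"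
  shows "log_rate p r (Suc i) - log_rate p r i =
    (r (Suc i) * ln (p i) + (1 - r (Suc i)) * ln (1 - p i))
    - (r (Suc i) * ln (p (Suc i)) + (1 - r (Suc i)) * ln (1 - p (Suc i)))"
  using assms by (simp add: log_rate_def odds_def ln_div algebra_simps)

(* An index outside the range of the argmax is strictly beaten by one of its neighbours,
   so the maximum over all indices is the maximum over that range. *)
lemma log_rate_less:
  fixes l i0 :: nat
  assumes p: "\<And>i. i \<le> l \<Longrightarrow> 0 < p i \<and> p i < 1" "\<And>i. i < l \<Longrightarrow> p i < p (Suc i)"
    and r: "\<And>i. i \<le> Suc l \<Longrightarrow> 0 \<le> r i \<and> r i \<le> 1" "r 0 = 0" "r (Suc l) = 1"
    and argmax: "argmax_set {i \<in> {0..l}. r i < p i \<and> p i < r (Suc i)} (\<lambda>i. exp (log_rate p r i)) = {i0}"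
    and i: "i \<le> l" "i \<noteq> i0"
  shows "log_rate p r i < log_rate p r i0"
proof -
  let ?C = "{i \<in> {0..l}. r i < p i \<and> p i < r (Suc i)}"
  have maximizer: "m = i0" if m: "m \<le> l" and max: "\<And>i. i \<le> l \<Longrightarrow> log_rate p r i \<le> log_rate p r m" for m
  proof -
    have "r m < p m"
    proof (rule ccontr)
      assume le: "\<not> r m < p m"
      \<comment> \<open>A left neighbour exists: \<open>m = 0\<close> is excluded by
        \<open>r 0 = 0 < p 0\<close>. It has the larger rate because
        \<open>p n < p m \<le> r m\<close>.\<close>
      then obtain n where n: "m = Suc n"
        using p(1)[of m] r(2) m by (cases m) auto
      have "(p n - p m) * (r m - p m) \<le> 0"
        using le p(2)[of n] m n by (intro mult_nonpos_nonneg) auto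
      then have "log_rate p r m < log_rate p r n"
        using log_rate_Suc[of p n r] mixed_ln_less[of "p n" "p m" "r m"] p(1)[of n] p(1)[of m]
          p(2)[of n] r(1)[of m] m n by auto
      then show False
        using max[of n] m n by auto
    qed
    moreover have "p m < r (Suc m)"
    proof (rule ccontr)
      assume le: "\<not> p m < r (Suc m)"
      \<comment> \<open>A right neighbour exists: \<open>m = l\<close> is excluded by
        \<open>p l < 1 = r (Suc l)\<close>.\<close>
      then have ml: "m < l"
        using p(1)[of m] r(3) m by (cases "m = l") auto
      have "(p (Suc m) - p m) * (r (Suc m) - p m) \<le> 0"
        using le p(2)[of m] ml by (intro mult_nonneg_nonpos) auto
      then have "log_rate p r m < log_rate p r (Suc m)"
        using log_rate_Suc[of p m r] mixed_ln_less[of "p (Suc m)" "p m" "r (Suc m)"] p(1)[of m]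
          p(1)[of "Suc m"] p(2)[of m] r(1)[of "Suc m"] ml by auto
      then show False
        using max[of "Suc m"] ml by auto
    qed
    ultimately have mC: "m \<in> ?C"
      using m by auto
    then have "Max ((\<lambda>i. exp (log_rate p r i)) ` ?C) = exp (log_rate p r m)"
      using max by (intro Max_eqI) auto
    then have "m \<in> argmax_set ?C (\<lambda>i. exp (log_rate p r i))"
      using mC by (simp add: argmax_set_def)
    then show "m = i0"
      using argmax by simp
  qed
  obtain m where m: "m \<le> l" "\<And>i. i \<le> l \<Longrightarrow> log_rate p r i \<le> log_rate p r m"
  proof -
    have "Max (log_rate p r ` {..l}) \<in> log_rate p r ` {..l}"
      by (intro Max_in) auto
    then obtain m where "m \<le> l" "Max (log_rate p r ` {..l}) = log_rate p r m"
      by (metis atMost_iff imageE)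
    then show ?thesis
      using that[of m] Max_ge[of "log_rate p r ` {..l}"] by force
  qed
  then have i0: "m = i0"
    by (rule maximizer)
  show ?thesis
  \<comment> \<open>Otherwise \<open>i\<close> would also be a global maximiser, hence equal to
    \<open>i0\<close>.\<close>
  proof (rule ccontr)
    assume "\<not> ?thesis"
    then have "i = i0"
      using m i i0 by (intro maximizer) force+
    then show False
      using i by simp
  qed
qed

text \<open>The logarithm of the ratio divided by \<open>N\<close> tends to the negative number
  \<open>log_rate p r i - log_rate p r j\<close>, so the ratio decays exponentially.\<close>

lemma peak_ratio_tendsto_0:
  assumes N: "\<And>N. l \<le> N \<Longrightarrow> thresholds l N (M N) p" and l: "1 \<le> l"
    and r: "\<And>i. i \<le> Suc l \<Longrightarrow> (\<lambda>N. real (M N i) / real N) \<longlonglongrightarrow> r i"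
    and ij: "i \<le> l" "j \<le> l" "log_rate p r i < log_rate p r j"
  shows "(\<lambda>N. peak (M N) p N i / peak (M N) p N j) \<longlonglongrightarrow> 0"
proof -
  define L where "L N i = ln (peak (M N) p N i) / real N" for N i
  have L: "(\<lambda>N. L N i) \<longlonglongrightarrow> log_rate p r i" if "i \<le> l" for i
  proof (rule Lim_transform_eventually)
    show "(\<lambda>N. (\<Sum>k<i. (real (M N (Suc k)) / real N - real (M N k) / real N) * ln (odds (p k)))
        - real (M N i) / real N * ln (p i) - (1 - real (M N i) / real N) * ln (1 - p i))
      \<longlonglongrightarrow> log_rate p r i"
      unfolding log_rate_def using that by (intro tendsto_intros r) auto
    show "\<forall>\<^sub>F N in sequentially. (\<Sum>k<i. (real (M N (Suc k)) / real N - real (M N k) / real N) * ln (odds (p k)))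
        - real (M N i) / real N * ln (p i) - (1 - real (M N i) / real N) * ln (1 - p i) = L N i"
      using eventually_ge_at_top[of l]
    proof eventually_elim
      case (elim N)
      then have "0 < real N"
        using l by simp
      then show ?case
        unfolding L_def thresholds.ln_peak[OF N[OF elim] that]
        by (simp add: diff_divide_distrib sum_divide_distrib left_diff_distrib)
    qed
  qed
  have "filterlim (\<lambda>N. (L N i - L N j) * real N) at_bot sequentially"
    using tendsto_diff[OF L[OF ij(1)] L[OF ij(2)]] ij(3)
    by (intro filterlim_tendsto_neg_mult_at_bot[where c = "log_rate p r i - log_rate p r j"]
        filterlim_real_sequentially) auto
  then have "(\<lambda>N. exp ((L N i - L N j) * real N)) \<longlonglongrightarrow> 0"
    by (rule filterlim_compose[OF exp_at_bot])
  then show ?thesis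
  proof (rule Lim_transform_eventually)
    show "\<forall>\<^sub>F N in sequentially. exp ((L N i - L N j) * real N) = peak (M N) p N i / peak (M N) p N j"
      using eventually_ge_at_top[of l]
    proof eventually_elim
      case (elim N)
      then have "real N \<noteq> 0"
        using l by simp
      then show ?case
        using thresholds.peak_pos[OF N[OF elim]] ij
        by (simp add: L_def left_diff_distrib exp_diff)
    qed
  qed
qed

section \<open>The walk\<close>

text \<open>Jumps in chronological order, \<open>True\<close> for right. The history window is then
  a suffix, obtained by \<open>drop\<close>.\<close>

definition jump_word :: "(nat \<Rightarrow> 'a \<Rightarrow> int) \<Rightarrow> nat \<Rightarrow> nat \<Rightarrow> 'a \<Rightarrow> bool list" where
  "jump_word X m n \<omega> = map (\<lambda>j. X (Suc j) \<omega> - X j \<omega> = 1) [m..<n]"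

lemma length_jump_word [simp]: "length (jump_word X m n \<omega>) = n - m"
  by (simp add: jump_word_def)

lemma drop_jump_word: "drop k (jump_word X m n \<omega>) = jump_word X (m + k) n \<omega>"
  by (simp add: jump_word_def drop_map)

lemma jump_word_Suc:
  "m \<le> n \<Longrightarrow> jump_word X m (Suc n) \<omega> = jump_word X m n \<omega> @ [X (Suc n) \<omega> - X n \<omega> = 1]"
  by (simp add: jump_word_def)

definition path_of :: "int \<Rightarrow> bool list \<Rightarrow> nat \<Rightarrow> int" where
  "path_of x0 h j = x0 + (\<Sum>i<j. if h ! i then 1 else -1)"

lemma right_jumps_path_of:
  assumes "length h = n"
  shows "right_jumps N (path_of x0 h) n = ones (drop (n - N) h)"
proof -
  have "ones s = length (filter id s)" for s
    by (induction s) auto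
  then have "ones (drop (n - N) h) = length (filter id (drop (n - N) h))" .
  also have "\<dots> = card {i. i < n - (n - N) \<and> h ! (n - N + i)}"
    by (simp add: length_filter_conv_card assms add.commute cong: conj_cong)
  also have "\<dots> = card {j \<in> {n - N..<n}. h ! j}"
    by (rule bij_betw_same_card[of "\<lambda>i. n - N + i"])
      (rule bij_betwI[where g = "\<lambda>j. j - (n - N)"], auto)
  also have "\<dots> = right_jumps N (path_of x0 h) n"
    unfolding right_jumps_def path_of_def by (intro arg_cong[where f = card]) auto
  finally show ?thesis ..
qed

locale threshold_walk =
  recent_history_walk P l N M p x0 X + thresholds l N M p
  for P :: "'a measure" and l N M p x0 and X :: "nat \<Rightarrow> 'a \<Rightarrow> int"
begin

declare X_measurable [measurable]

lemma jump_word_measurable [measurable]: "jump_word X m n \<in> measurable P (count_space UNIV)"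
proof (induction n)
  case (Suc n)
  show ?case
  proof (cases "m \<le> n")
    case True
    note Suc [measurable]
    have "(\<lambda>\<omega>. jump_word X m n \<omega> @ [X (Suc n) \<omega> - X n \<omega> = 1]) \<in> measurable P (count_space UNIV)"
      by measurable
    then show ?thesis
      using True by (simp add: jump_word_Suc cong: measurable_cong)
  qed (simp add: jump_word_def)
qed (simp add: jump_word_def)

section \<open>The law of jump words and its recursion\<close>

definition law :: "bool list \<Rightarrow> real" where
  "law h = \<P>(\<omega> in P. jump_word X 0 (length h) \<omega> = h)"

lemma law_nonneg: "0 \<le> law h"
  by (simp add: law_def)

lemma prob_jump_word:
  "\<P>(\<omega> in P. Q (jump_word X 0 n \<omega>)) = (\<Sum>h\<in>words n. law h * of_bool (Q h))"
proof -
  have "{\<omega> \<in> space P. Q (jump_word X 0 n \<omega>)}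
      = (\<Union>h\<in>{h\<in>words n. Q h}. {\<omega> \<in> space P. jump_word X 0 n \<omega> = h})"
    by (auto simp: words_def)
  also have "prob \<dots> = (\<Sum>h\<in>{h\<in>words n. Q h}. \<P>(\<omega> in P. jump_word X 0 n \<omega> = h))"
    by (intro finite_measure_finite_Union) (auto simp: disjoint_family_on_def)
  also have "\<dots> = (\<Sum>h\<in>{h\<in>words n. Q h}. law h)"
    by (intro sum.cong) (auto simp: law_def length_words)
  also have "\<dots> = (\<Sum>h\<in>words n. law h * of_bool (Q h))"
    by (rule sum.mono_neutral_cong_left) auto
  finally show ?thesis .
qed

lemma sum_law: "(\<Sum>h\<in>words n. law h) = 1"
  using prob_jump_word[of "\<lambda>_. True" n] prob_space by simp

text \<open>The starting point and the jump sizes are prescribed only almost surely, so words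
  determine paths only up to a null set.\<close>

lemma AE_jump_word_path: "AE \<omega> in P. jump_word X 0 (length h) \<omega> = h \<longleftrightarrow> (\<forall>j\<le>length h. X j \<omega> = path_of x0 h j)"
proof -
  have "AE \<omega> in P. \<forall>n. X (Suc n) \<omega> - X n \<omega> \<in> {-1, 1}"
    using jumps by (simp add: AE_all_countable)
  with start show ?thesis
  proof eventually_elim
    case (elim \<omega>)
    show ?case
    proof
      assume eq: "jump_word X 0 (length h) \<omega> = h"
      have "X (Suc j) \<omega> - X j \<omega> = 1 \<longleftrightarrow> h ! j" if "j < length h" for j
        using arg_cong[OF eq, of "\<lambda>w. w ! j"] that by (simp add: jump_word_def)
      moreover have "X (Suc j) \<omega> - X j \<omega> = -1 \<or> X (Suc j) \<omega> - X j \<omega> = 1" for j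
        using elim(2) by blast
      ultimately have "X (Suc j) \<omega> = X j \<omega> + (if h ! j then 1 else -1)" if "j < length h" for j
        using that by (smt (verit))
      then have "j \<le> length h \<Longrightarrow> X j \<omega> = path_of x0 h j" for j
        by (induction j) (auto simp: path_of_def elim(1))
      then show "\<forall>j\<le>length h. X j \<omega> = path_of x0 h j"
        by blast
    next
      assume path: "\<forall>j\<le>length h. X j \<omega> = path_of x0 h j"
      show "jump_word X 0 (length h) \<omega> = h"
        by (rule nth_equalityI) (auto simp: jump_word_def path path_of_def)
    qed
  qed
qed

lemma law_True:
  assumes "N \<le> length h"
  shows "law (h @ [True]) = jump_prob (drop (length h - N) h) True * law h"
proof -
  define n where "n = length h"
  define i where "i = zone M l (ones (drop (n - N) h))"
  define path where "path \<omega> \<longleftrightarrow> (\<forall>j\<le>n. X j \<omega> = path_of x0 h j)" for \<omega>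
  have [measurable]: "Measurable.pred P path"
    unfolding path_def by measurable
  have "law h = \<P>(\<omega> in P. path \<omega>)"
    unfolding law_def n_def [symmetric]
  proof (rule finite_measure_eq_AE)
    show "AE \<omega> in P. \<omega> \<in> {\<omega> \<in> space P. jump_word X 0 n \<omega> = h} \<longleftrightarrow> \<omega> \<in> {\<omega> \<in> space P. path \<omega>}"
      using AE_jump_word_path[of h] by eventually_elim (auto simp: path_def n_def)
  qed auto
  moreover have "law (h @ [True]) = \<P>(\<omega> in P. X (Suc n) \<omega> - X n \<omega> = 1 \<and> path \<omega>)"
    unfolding law_def
  proof (rule finite_measure_eq_AE)
    show "AE \<omega> in P. \<omega> \<in> {\<omega> \<in> space P. jump_word X 0 (length (h @ [True])) \<omega> = h @ [True]}
        \<longleftrightarrow> \<omega> \<in> {\<omega> \<in> space P. X (Suc n) \<omega> - X n \<omega> = 1 \<and> path \<omega>}"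
      using AE_jump_word_path[of h] by eventually_elim (auto simp: path_def n_def jump_word_Suc)
  qed auto
  moreover have "\<P>(\<omega> in P. X (Suc n) \<omega> - X n \<omega> = 1 \<and> path \<omega>) = p i * \<P>(\<omega> in P. path \<omega>)"
  \<comment> \<open>The conditional probability is prescribed only for paths of positive
    probability; for the others both sides vanish.\<close>
  proof (cases "\<P>(\<omega> in P. path \<omega>) = 0")
    case True
    have "\<P>(\<omega> in P. X (Suc n) \<omega> - X n \<omega> = 1 \<and> path \<omega>) \<le> \<P>(\<omega> in P. path \<omega>)"
      by (intro finite_measure_mono) auto
    then show ?thesis
      using True measure_nonneg[of P] by (simp add: antisym)
  next
    case False
    have "ones (drop (n - N) h) \<le> N"
      using ones_le_length[of "drop (n - N) h"] by (simp add: n_def)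
    then have "M i \<le> right_jumps N (path_of x0 h) n" "right_jumps N (path_of x0 h) n < M (Suc i)"
      unfolding i_def right_jumps_path_of[OF n_def [symmetric]] using zone_bounds by auto
    then have "\<P>(\<omega> in P. X (Suc n) \<omega> - X n \<omega> = 1 \<bar> path \<omega>) = p i"
      using step_right[of n i "path_of x0 h"] assms zone_le False
      by (simp add: path_def n_def i_def zero_less_measure_iff)
    then show ?thesis
      using False by (simp add: cond_prob_def field_simps)
  qed
  ultimately show ?thesis
    by (simp add: jump_prob_def i_def n_def)
qed

lemma law_snoc:
  assumes "N \<le> length h"
  shows "law (h @ [b]) = jump_prob (drop (length h - N) h) b * law h"
proof -
  have "law h = law (h @ [True]) + law (h @ [False])"
  proof -
    have "{\<omega> \<in> space P. jump_word X 0 (length h) \<omega> = h}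
        = {\<omega> \<in> space P. jump_word X 0 (Suc (length h)) \<omega> = h @ [True]}
        \<union> {\<omega> \<in> space P. jump_word X 0 (Suc (length h)) \<omega> = h @ [False]}"
      by (auto simp: jump_word_Suc)
    then show ?thesis
      unfolding law_def by (simp, subst finite_measure_Union) auto
  qed
  then show ?thesis
    using law_True[OF assms] jump_prob_Not[of "drop (length h - N) h" True]
    by (cases b) (auto simp: jump_prob_def algebra_simps)
qed

text \<open>The Markov property: averaging over the last letter replaces \<open>f\<close> by
  \<open>step f\<close> on the preceding window, so \<open>t\<close> rounds lead back to the law of
  the first \<open>N\<close> jumps.\<close>

lemma law_window:
  "(\<Sum>h\<in>words (N + t). law h * f (drop t h)) = (\<Sum>h\<in>words N. law h * (step ^^ t) f h)"
proof (induction t arbitrary: f)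
  case (Suc t)
  have "(\<Sum>h\<in>words (N + Suc t). law h * f (drop (Suc t) h))
      = (\<Sum>h\<in>words (N + t). law h * step f (drop t h))"
    unfolding add_Suc_right sum_words_snoc
  proof (rule sum.cong[OF refl])
    fix h assume "h \<in> words (N + t)"
    then have h: "length h = N + t"
      by (simp add: length_words)
    then have "drop (Suc t) (h @ [b]) = tl (drop t h) @ [b]" for b
      using N_pos by (simp add: drop_Suc tl_drop)
    then show "law (h @ [True]) * f (drop (Suc t) (h @ [True]))
        + law (h @ [False]) * f (drop (Suc t) (h @ [False])) = law h * step f (drop t h)"
      using h by (simp add: law_snoc step_def algebra_simps)
  qed
  also have "\<dots> = (\<Sum>h\<in>words N. law h * (step ^^ Suc t) f h)"
    unfolding Suc.IH by (simp add: funpow_swap1)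
  finally show ?case .
qed simp

text \<open>The window starting at jump \<open>t\<close> is the one that governs the jump made at
  time \<open>N + t\<close>.\<close>

definition outside :: "nat \<Rightarrow> nat \<Rightarrow> real" where
  "outside j t = \<P>(\<omega> in P. zone M l (ones (jump_word X t (N + t) \<omega>)) \<noteq> j)"

lemma outside_eq:
  "outside j t = (\<Sum>h\<in>words (N + t). law h * of_bool (zone M l (ones (drop t h)) \<noteq> j))"
  using prob_jump_word[of "\<lambda>h. zone M l (ones (drop t h)) \<noteq> j" "N + t"]
  by (simp add: outside_def drop_jump_word)

lemma eventually_outside_le:
  assumes "j \<le> l" "0 < \<epsilon>"
  shows "\<exists>\<tau>. \<forall>t\<ge>\<tau>. outside j t
    \<le> (\<Sum>i\<in>{..l} - {j}. peak M p N i / peak M p N j) / (1 - p l) + \<epsilon>"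
proof -
  define f :: "bool list \<Rightarrow> real" where "f s = of_bool (zone M l (ones s) \<noteq> j)" for s
  obtain \<tau> where \<tau>: "\<forall>n\<ge>\<tau>. \<forall>f a. (\<forall>s\<in>words N. 0 \<le> f s \<and> f s \<le> 1) \<longrightarrow>
    (\<forall>s\<in>words N. 0 \<le> a s) \<longrightarrow> (\<Sum>s\<in>words N. a s) = 1 \<longrightarrow>
    \<bar>(\<Sum>s\<in>words N. a s * (step ^^ n) f s) -
      (\<Sum>s\<in>words N. stat s * f s) / (\<Sum>s\<in>words N. stat s)\<bar> \<le> \<epsilon>"
    using uniform_ergodicity[OF assms(2)] ..
  show ?thesis
  proof (intro exI allI impI)
    fix t assume "\<tau> \<le> t"
    then have "\<bar>(\<Sum>s\<in>words N. law s * (step ^^ t) f s) -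
        (\<Sum>s\<in>words N. stat s * f s) / (\<Sum>s\<in>words N. stat s)\<bar> \<le> \<epsilon>"
      by (intro \<tau>[rule_format]) (auto simp: f_def law_nonneg sum_law)
    moreover have "outside j t = (\<Sum>s\<in>words N. law s * (step ^^ t) f s)"
      unfolding outside_eq law_window [symmetric] f_def ..
    ultimately show "outside j t \<le> (\<Sum>i\<in>{..l} - {j}. peak M p N i / peak M p N j) / (1 - p l) + \<epsilon>"
      using stat_ratio_outside_le[OF assms(1)] unfolding f_def by linarith
  qed
qed

section \<open>Probabilities of blocks of late jumps\<close>

definition word_prob :: "nat \<Rightarrow> bool list \<Rightarrow> real" where
  "word_prob n e = \<P>(\<omega> in P. jump_word X n (n + length e) \<omega> = e)"

lemma word_prob_eq:
  "word_prob n e = (\<Sum>h\<in>words (n + length e). law h * of_bool (drop n h = e))"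
  using prob_jump_word[of "\<lambda>h. drop n h = e" "n + length e"]
  by (simp add: word_prob_def drop_jump_word)

lemma word_prob_Nil: "word_prob n [] = 1"
  using prob_space by (simp add: word_prob_def jump_word_def)

text \<open>While the window is in zone \<open>j\<close>, the next letter has exactly the
  probability used here; the error is at most the chance that the window just before that jump is
  elsewhere.\<close>

lemma word_prob_snoc:
  assumes "j \<le> l"
  shows "\<bar>word_prob (N + t) (e @ [b]) - (if b then p j else 1 - p j) * word_prob (N + t) e\<bar>
    \<le> outside j (t + length e)"
proof -
  define pb where "pb = (if b then p j else 1 - p j)"
  define n where "n = N + t + length e"
  define w where "w h = drop (t + length e) h" for h :: "bool list"
  have "word_prob (N + t) (e @ [b]) = (\<Sum>h\<in>words n. law (h @ [b]) * of_bool (drop (N + t) h = e))"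
  proof -
    have "word_prob (N + t) (e @ [b]) = (\<Sum>h\<in>words (Suc n). law h * of_bool (drop (N + t) h = e @ [b]))"
      using word_prob_eq[of "N + t" "e @ [b]"] by (simp add: n_def)
    also have "\<dots> = (\<Sum>h\<in>words n. law (h @ [b]) * of_bool (drop (N + t) h = e))"
      unfolding sum_words_snoc by (rule sum.cong[OF refl]) (cases b; simp add: length_words n_def)
    finally show ?thesis .
  qed
  also have "\<dots> - pb * word_prob (N + t) e
      = (\<Sum>h\<in>words n. law h * (jump_prob (w h) b - pb) * of_bool (drop (N + t) h = e))"
    unfolding word_prob_eq n_def [symmetric] sum_distrib_left sum_subtractf [symmetric]
    by (rule sum.cong[OF refl]) (simp add: law_snoc w_def length_words n_def algebra_simps)
  also have "\<bar>\<dots>\<bar> \<le> (\<Sum>h\<in>words n. law h * of_bool (zone M l (ones (w h)) \<noteq> j))"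
  proof (rule order.trans[OF sum_abs], rule sum_mono)
    fix h
    have "\<bar>jump_prob (w h) b - pb\<bar> \<le> of_bool (zone M l (ones (w h)) \<noteq> j)"
      using jump_prob_nonneg[of "w h" b] jump_prob_le_1[of "w h" b] p_pos[OF assms] p_less_1[OF assms]
      by (auto simp: pb_def jump_prob_def)
    then show "\<bar>law h * (jump_prob (w h) b - pb) * of_bool (drop (N + t) h = e)\<bar>
        \<le> law h * of_bool (zone M l (ones (w h)) \<noteq> j)"
      using mult_left_mono[OF _ law_nonneg[of h]] law_nonneg[of h] by (fastforce simp: abs_mult)
  qed
  also have "\<dots> = outside j (t + length e)"
    by (simp add: outside_eq n_def w_def add.assoc)
  finally show ?thesis
    by (simp add: pb_def)
qed

lemma prob_jumps_eq_word_prob: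
  assumes e: "\<forall>k\<in>{1..m}. e k \<in> {-1, 1}"
  shows "\<P>(\<omega> in P. \<forall>k\<in>{1..m}. X (n + k) \<omega> - X (n + (k - 1)) \<omega> = e k)
    = word_prob n (map (\<lambda>k. e k = 1) [1..<Suc m])"
  unfolding word_prob_def
proof (rule finite_measure_eq_AE)
  have "AE \<omega> in P. \<forall>n. X (Suc n) \<omega> - X n \<omega> \<in> {-1, 1}"
    using jumps by (simp add: AE_all_countable)
  then show "AE \<omega> in P. \<omega> \<in> {\<omega> \<in> space P. \<forall>k\<in>{1..m}. X (n + k) \<omega> - X (n + (k - 1)) \<omega> = e k}
    \<longleftrightarrow> \<omega> \<in> {\<omega> \<in> space P. jump_word X n (n + length (map (\<lambda>k. e k = 1) [1..<Suc m])) \<omega>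
          = map (\<lambda>k. e k = 1) [1..<Suc m]}"
  proof eventually_elim
    case (elim \<omega>)
    \<comment> \<open>The prescribed jumps are numbered from 1, the letters of a word from
      0.\<close>
    have "{1..m} = Suc ` {..<m}"
      by (simp add: image_Suc_lessThan)
    then have "(\<forall>k\<in>{1..m}. X (n + k) \<omega> - X (n + (k - 1)) \<omega> = e k)
        \<longleftrightarrow> (\<forall>i<m. X (Suc (n + i)) \<omega> - X (n + i) \<omega> = e (Suc i))"
      by auto
    also have "\<dots> \<longleftrightarrow> (\<forall>i<m. (X (Suc (n + i)) \<omega> - X (n + i) \<omega> = 1) = (e (Suc i) = 1))"
    proof (intro all_cong1 imp_cong refl)
      fix i assume "i < m"
      then have "e (Suc i) = -1 \<or> e (Suc i) = 1"
        using e by force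
      moreover have "X (Suc (n + i)) \<omega> - X (n + i) \<omega> = -1 \<or> X (Suc (n + i)) \<omega> - X (n + i) \<omega> = 1"
        using elim by blast
      ultimately show "(X (Suc (n + i)) \<omega> - X (n + i) \<omega> = e (Suc i)) =
          ((X (Suc (n + i)) \<omega> - X (n + i) \<omega> = 1) = (e (Suc i) = 1))"
        by auto
    qed
    also have "\<dots> \<longleftrightarrow> jump_word X n (n + m) \<omega> = map (\<lambda>k. e k = 1) [1..<Suc m]"
      by (auto simp: list_eq_iff_nth_eq jump_word_def simp del: upt_Suc)
    finally show ?case
      by (simp del: upt_Suc)
  qed
qed auto

end


section \<open>Choice of the times and passage to the limit\<close>

theorem theorem5:
  fixes l i0 :: nat
    and p r :: "nat \<Rightarrow> real"
    and M :: "nat \<Rightarrow> nat \<Rightarrow> nat"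
    and P :: "nat \<Rightarrow> 'a measure"
    and X :: "nat \<Rightarrow> nat \<Rightarrow> 'a \<Rightarrow> int"
    and x0 :: int
  assumes "l \<ge> 1"
    and "0 < p 0" and "\<And>i. i < l \<Longrightarrow> p i < p (Suc i)" and "p l < 1"
    and "\<And>N. N \<ge> l \<Longrightarrow> M N 0 = 0"
    and "\<And>N. N \<ge> l \<Longrightarrow> M N (Suc l) = N + 1"
    and "\<And>N. N \<ge> l \<Longrightarrow> 1 \<le> M N 1"
    and "\<And>N i. N \<ge> l \<Longrightarrow> 1 \<le> i \<Longrightarrow> i < l \<Longrightarrow> M N i < M N (Suc i)"
    and "\<And>N. N \<ge> l \<Longrightarrow> M N l \<le> N"
    and "r 0 = 0" and "r (Suc l) = 1"
    and "\<And>i. i \<in> {1..l} \<Longrightarrow> (\<lambda>N. real (M N i) / real N) \<longlonglongrightarrow> r i"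
    and "\<And>N. N \<ge> l \<Longrightarrow> recent_history_walk (P N) l N (M N) p x0 (X N)"
    and "argmax_set {i \<in> {0..l}. r i < p i \<and> p i < r (Suc i)}
           (\<lambda>i. 1 / (p i powr r i * (1 - p i) powr (1 - r i)) *
             (\<Prod>k=1..i. (p (k - 1) / (1 - p (k - 1))) powr (r k - r (k - 1)))) = {i0}"
  shows "\<exists>\<tau> :: nat \<Rightarrow> nat. \<forall>T :: nat \<Rightarrow> nat.
           filterlim T at_top sequentially \<longrightarrow> (\<forall>N. T N \<ge> \<tau> N) \<longrightarrow>
           (\<forall>m\<ge>1. \<forall>e :: nat \<Rightarrow> int. (\<forall>k\<in>{1..m}. e k \<in> {-1, 1}) \<longrightarrow>
             (\<lambda>N. \<P>(\<omega> in P N. \<forall>k\<in>{1..m}.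
                 X N (N + T N + k) \<omega> - X N (N + T N + (k - 1)) \<omega> = e k))
               \<longlonglongrightarrow> p i0 ^ card {k \<in> {1..m}. e k = 1} * (1 - p i0) ^ card {k \<in> {1..m}. e k = -1})"
proof -
  have thr: "thresholds l N (M N) p" if "N \<ge> l" for N
  proof
    show "M N i < M N (Suc i)" if "i \<le> l" for i
    \<comment> \<open>The two boundary inequalities come from \<open>1 \<le> M N 1\<close> and
      \<open>M N l \<le> N\<close>.\<close>
    proof (cases "i = 0 \<or> i = l")
      case True
      then show ?thesis
        using assms(1,5-9) \<open>N \<ge> l\<close> by (auto simp: Suc_le_eq le_imp_less_Suc)
    qed (use assms(8) \<open>N \<ge> l\<close> that in auto)
  qed (use assms(1-6) that in auto)
  have walk: "threshold_walk (P N) l N (M N) p x0 (X N)" if "N \<ge> l" for N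
    using assms(13)[OF that] thr[OF that] by (rule threshold_walk.intro)
  have p: "0 < p i \<and> p i < 1" if "i \<le> l" for i
    using thresholds.p_pos[OF thr[OF order.refl] that] thresholds.p_less_1[OF thr[OF order.refl] that] by simp
  have r_lim: "(\<lambda>N. real (M N i) / real N) \<longlonglongrightarrow> r i" if "i \<le> Suc l" for i
  proof -
    consider "i = 0" | "i \<in> {1..l}" | "i = Suc l"
      using \<open>i \<le> Suc l\<close> by force
    then show ?thesis
    proof cases
      case 1
      have "\<forall>\<^sub>F N in sequentially. 0 = real (M N i) / real N"
        using eventually_ge_at_top[of l] by eventually_elim (simp add: 1 assms(5))
      then show ?thesis
        using assms(10) 1 by (auto intro: Lim_transform_eventually[OF tendsto_const])
    next
      case 3
      have "(\<lambda>N. real (Suc N) / real N) \<longlonglongrightarrow> 1"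
        by (rule LIMSEQ_Suc_n_over_n)
      then show ?thesis
        unfolding 3 assms(11)
      proof (rule Lim_transform_eventually)
        show "\<forall>\<^sub>F N in sequentially. real (Suc N) / real N = real (M N (Suc l)) / real N"
          using eventually_ge_at_top[of l] by eventually_elim (simp add: assms(6))
      qed
    qed (rule assms(12))
  qed
  have r: "0 \<le> r i \<and> r i \<le> 1" if "i \<le> Suc l" for i
  proof (cases "i = Suc l")
    case False
    have "real (M N i) / real N \<le> 1" if "N \<ge> l" for N
      using thresholds.M_le_N[OF thr[OF that], of i] \<open>i \<le> Suc l\<close> False
      by (cases "N = 0") (simp_all add: divide_le_eq_1)
    then have "r i \<le> 1"
      by (intro LIMSEQ_le_const2[OF r_lim[OF that]]) blast
    moreover have "0 \<le> r i"
      by (rule LIMSEQ_le_const[OF r_lim[OF that]]) simp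
    ultimately show ?thesis
      by simp
  qed (simp add: assms(11))
  let ?C = "{i \<in> {0..l}. r i < p i \<and> p i < r (Suc i)}"
  have "argmax_set ?C (\<lambda>i. exp (log_rate p r i)) = argmax_set ?C
      (\<lambda>i. 1 / (p i powr r i * (1 - p i) powr (1 - r i)) *
             (\<Prod>k=1..i. (p (k - 1) / (1 - p (k - 1))) powr (r k - r (k - 1))))"
    unfolding argmax_set_def using p exp_log_rate[of _ p r]
    by (intro Collect_cong conj_cong refl arg_cong2[where f = "(=)"] arg_cong[where f = Max] image_cong) auto
  then have argmax: "argmax_set ?C (\<lambda>i. exp (log_rate p r i)) = {i0}"
    using assms(14) by simp
  then have i0: "i0 \<le> l"
    unfolding argmax_set_def by auto
  define R where "R N = (\<Sum>i\<in>{..l} - {i0}. peak (M N) p N i / peak (M N) p N i0) / (1 - p l)" for N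
  have "(\<lambda>N. peak (M N) p N i / peak (M N) p N i0) \<longlonglongrightarrow> 0" if "i \<in> {..l} - {i0}" for i
    using that i0 log_rate_less[OF p assms(3) r assms(10,11) argmax]
    by (intro peak_ratio_tendsto_0[OF thr assms(1) r_lim]) auto
  then have "R \<longlonglongrightarrow> (\<Sum>i\<in>{..l} - {i0}. 0) / (1 - p l)"
    unfolding R_def using assms(4) by (intro tendsto_divide tendsto_sum tendsto_const) auto
  then have R: "R \<longlonglongrightarrow> 0"
    by simp
  define out where "out N = threshold_walk.outside (P N) l N (M N) (X N) i0" for N
  \<comment> \<open>For each \<open>N\<close> a mixing time is taken at accuracy
    \<open>1 / Suc N\<close>, which is positive and vanishes in the limit. The bound holds at all
    later times, so one choice of \<tau> serves every admissible \<open>T\<close>.\<close>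
  have "\<forall>N. \<exists>\<tau>. N \<ge> l \<longrightarrow> (\<forall>t\<ge>\<tau>. out N t \<le> R N + 1 / real (Suc N))"
    unfolding out_def R_def using threshold_walk.eventually_outside_le[OF walk i0] by simp
  then obtain \<tau> where \<tau>: "\<And>N t. N \<ge> l \<Longrightarrow> \<tau> N \<le> t \<Longrightarrow> out N t \<le> R N + 1 / real (Suc N)"
    by metis
  show ?thesis
  proof (intro exI[of _ \<tau>] allI impI)
    fix T :: "nat \<Rightarrow> nat" and m :: nat and e :: "nat \<Rightarrow> int"
    assume T: "\<forall>N. \<tau> N \<le> T N" and e: "\<forall>k\<in>{1..m}. e k \<in> {-1, 1}"
    define wp where "wp N = threshold_walk.word_prob (P N) (X N) (N + T N)" for N
    have out_lim: "(\<lambda>N. out N (T N + k)) \<longlonglongrightarrow> 0" for k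
    proof (rule tendsto_sandwich)
      show "\<forall>\<^sub>F N in sequentially. 0 \<le> out N (T N + k)"
        using eventually_ge_at_top[of l]
        by eventually_elim (simp add: out_def threshold_walk.outside_def[OF walk])
      show "\<forall>\<^sub>F N in sequentially. out N (T N + k) \<le> R N + 1 / real (Suc N)"
        using eventually_ge_at_top[of l]
      proof eventually_elim
        case (elim N)
        then show ?case
          using T by (intro \<tau>) (auto intro: trans_le_add1)
      qed
      show "(\<lambda>N. R N + 1 / real (Suc N)) \<longlonglongrightarrow> 0"
        by (rule tendsto_add_zero[OF R LIMSEQ_Suc[OF lim_1_over_n]])
    qed simp
    \<comment> \<open>Each appended letter multiplies the limit by its probability under
      \<open>p i0\<close>, since the error is bounded by \<open>out\<close> at the fixed shift
      \<open>length w\<close> and vanishes.\<close>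
    have wp_lim: "(\<lambda>N. wp N w) \<longlonglongrightarrow> p i0 ^ ones w * (1 - p i0) ^ count_list w False" for w
    proof (induction w rule: rev_induct)
      case Nil
      have "\<forall>\<^sub>F N in sequentially. 1 = wp N []"
        using eventually_ge_at_top[of l]
        by eventually_elim (simp add: wp_def threshold_walk.word_prob_Nil[OF walk])
      then show ?case
        by (auto intro: Lim_transform_eventually[OF tendsto_const])
    next
      case (snoc b w)
      define pb where "pb = (if b then p i0 else 1 - p i0)"
      have "\<forall>\<^sub>F N in sequentially. norm (wp N (w @ [b]) - pb * wp N w) \<le> out N (T N + length w)"
        using eventually_ge_at_top[of l]
        by eventually_elim (use threshold_walk.word_prob_snoc[OF walk i0] in \<open>simp add: wp_def out_def pb_def\<close>)
      then have "(\<lambda>N. wp N (w @ [b]) - pb * wp N w) \<longlonglongrightarrow> 0"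
        using out_lim by (rule Lim_null_comparison)
      from tendsto_add[OF this tendsto_mult_left[OF snoc, of pb]]
      show ?case
        by (cases b) (simp_all add: pb_def mult_ac)
    qed
    have card_count: "card {k \<in> {1..m}. Q k = b} = count_list (map Q [1..<Suc m]) b" for Q :: "nat \<Rightarrow> bool" and b
    proof (induction m)
      case (Suc m)
      have "{k \<in> {1..Suc m}. Q k = b} = {k \<in> {1..m}. Q k = b} \<union> (if Q (Suc m) = b then {Suc m} else {})"
        by (auto simp: le_Suc_eq)
      moreover have "[1..<Suc (Suc m)] = [1..<Suc m] @ [Suc m]"
        by simp
      ultimately show ?case
        using Suc by (simp del: upt_Suc)
    qed simp
    have "e k = -1 \<longleftrightarrow> e k \<noteq> 1" if "k \<in> {1..m}" for k
      using bspec[OF e that] by auto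
    then have left: "{k \<in> {1..m}. e k = -1} = {k \<in> {1..m}. (e k = 1) = False}"
      by auto
    let ?w = "map (\<lambda>k. e k = 1) [1..<Suc m]"
    have exps: "card {k \<in> {1..m}. e k = 1} = ones ?w" "card {k \<in> {1..m}. e k = -1} = count_list ?w False"
      unfolding left card_count [symmetric] by simp_all
    show "(\<lambda>N. \<P>(\<omega> in P N. \<forall>k\<in>{1..m}. X N (N + T N + k) \<omega> - X N (N + T N + (k - 1)) \<omega> = e k))
      \<longlonglongrightarrow> p i0 ^ card {k \<in> {1..m}. e k = 1} * (1 - p i0) ^ card {k \<in> {1..m}. e k = -1}"
      unfolding exps
    proof (rule Lim_transform_eventually[OF wp_lim])
      show "\<forall>\<^sub>F N in sequentially. wp N ?w
        = \<P>(\<omega> in P N. \<forall>k\<in>{1..m}. X N (N + T N + k) \<omega> - X N (N + T N + (k - 1)) \<omega> = e k)"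
        using eventually_ge_at_top[of l]
        by eventually_elim (simp only: wp_def threshold_walk.prob_jumps_eq_word_prob[OF walk e])
    qed
  qed
qed

end
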